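(* Let $S$ be a left cancellative monoid generated by a finite set $A$. Then $S$ is finitely presented if and only if the right Cayley graph $\Gamma_r(S,A)$ is quasi-simply-connected. Moreover, for every $n\in\mathbb{N}$, if $\Gamma_r(S,A)$ is $n$-quasi-simply-connected then the Dehn function of $K_n(\Gamma_r(S,A))$ is equivalent (of the same type, $\sim$) to the Dehn function of $S$.
   Context: A monoid $S$ is left cancellative if $xy=xz$ implies $y=z$ for all $x,y,z\in S$. A monoid is finitely presented if it is defined by some presentation $\langle B\mid R\rangle$ with $B$, $R$ finite. The right Cayley graph $\Gamma_r(S,A)$ is the directed graph with vertex set $S$ and an edge from $x$ to $y$ if and only if $xa=y$ for some $a\in A$. Let $\Gamma$ be a directed graph. Directed paths (including empty paths, one at each vertex) are called $1$-paths; $|p|$ denotes the length of $p$. Two paths $p,q$ are parallel, $p\parallel q$, if they have the same start vertex and the same end vertex. For $n\in\mathbb{N}$, $K_n(\Gamma)$ is the directed $2$-complex on $\Gamma$ whose $2$-cells are the pairs $f=(p,q)$ of parallel paths in $\Gamma$ with $|p|+|q|\le n$, with top $\lceil f\rceil=p$, bottom $\lfloor f\rfloor=q$, and inverse $(q,p)$. An atomic $2$-path is a triple $\delta=(u,f,v)$ with $u,v$ paths in $\Gamma$ and $f$ a $2$-cell such that $u$ ends where $\lceil f\rceil$ starts and $v$ starts where $\lceil f\rceil$ ends; its top is $\lceil\delta\rceil=u\lceil f\rceil v$ and its bottom is $\lfloor\delta\rfloor=u\lfloor f\rfloor v$. A $2$-path of length $k$ from $p$ to $q$ is a sequence of atomic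 $2$-paths $\delta_1,\dots,\delta_k$ with $\lceil\delta_1\rceil=p$, $\lfloor\delta_i\rfloor=\lceil\delta_{i+1}\rceil$ for $1\le i<k$, and $\lfloor\delta_k\rfloor=q$ (from $p$ to $p$ the trivial $2$-path of length $0$ is allowed). $K_n(\Gamma)$ is directed simply connected if for every pair of parallel paths $p\parallel q$ in $\Gamma$ there is a $2$-path from $p$ to $q$. $\Gamma$ is $n$-quasi-simply-connected if $K_n(\Gamma)$ is directed simply connected, and quasi-simply-connected if it is $n$-quasi-simply-connected for some $n\in\mathbb{N}$. If $K_n(\Gamma)$ is directed simply connected, the area of a pair $p\parallel q$ is the minimum length of a $2$-path from $p$ to $q$ in $K_n(\Gamma)$, and the Dehn function of $K_n(\Gamma)$ is $\gamma:\mathbb{N}\to\mathbb{N}\cup\{\infty\}$, where $\gamma(i)$ is the supremum of the areas of all pairs $p\parallel q$ of paths in $\Gamma$ with $|p|+|q|\le i$ (the supremum of an unbounded set being $\infty$). For a finite monoid presentation $\langle B\mid R\rangle$ and words $u,v\in B^*$ representing the same element, the area $A(u,v)$ is the smallest number of applications of relations from $R$ needed to transform $u$ into $v$; the Dehn function of the presentation is $\delta(n)=\max\{A(u,v): u,v\in B^*,\ u\equiv_R v,\ |u|+|v|\le n\}$. For functions $f,g$ on $\mathbb{N}$ write $f\prec g$ if there is a constant $a$ with $f(j)\le a\,g(aj)+aj$ for all $j$; $f\sim g$ ($f$ and $g$ are of the same type, or equivalent) means $f\prec g$ and $g\prec f$. Dehn functions of different finite presentations of the same monoid are $\sim$-equivalent;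 "the Dehn function of $S$" means the Dehn function of any finite presentation of $S$, defined up to $\sim$. *)

theory Defs
  imports
    "Graph_Theory.Pair_Digraph"
    "Graph_Theory.Vertex_Walk"
    "HOL-Library.Extended_Nat"
    "HOL-Algebra.Group"
begin

definition left_cancellative :: "('a, 'm) monoid_scheme \<Rightarrow> bool" where
  "left_cancellative S \<longleftrightarrow>
     (\<forall>x\<in>carrier S. \<forall>y\<in>carrier S. \<forall>z\<in>carrier S.
        x \<otimes>\<^bsub>S\<^esub> y = x \<otimes>\<^bsub>S\<^esub> z \<longrightarrow> y = z)"

definition generated_by :: "('a, 'm) monoid_scheme \<Rightarrow> 'a set \<Rightarrow> bool" where
  "generated_by S A \<longleftrightarrow>
     A \<subseteq> carrier S \<and> (\<forall>H. submonoid H S \<and> A \<subseteq> H \<longrightarrow> H = carrier S)"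

definition cayley_graph :: "('a, 'm) monoid_scheme \<Rightarrow> 'a set \<Rightarrow> 'a pair_pre_digraph" where
  "cayley_graph S A =
     \<lparr> pverts = carrier S,
       parcs = {(x, y). x \<in> carrier S \<and> y \<in> carrier S \<and> (\<exists>a\<in>A. x \<otimes>\<^bsub>S\<^esub> a = y)} \<rparr>"

definition finite_presentation :: "'b set \<Rightarrow> ('b list \<times> 'b list) set \<Rightarrow> bool" where
  "finite_presentation B R \<longleftrightarrow> finite B \<and> finite R \<and> R \<subseteq> lists B \<times> lists B"

definition rel_step :: "'b set \<Rightarrow> ('b list \<times> 'b list) set \<Rightarrow> ('b list \<times> 'b list) set" where
  "rel_step B R =
     {(x @ l @ y, x @ r @ y) | x y l r.
        x \<in> lists B \<and> y \<in> lists B \<and> ((l, r) \<in> R \<or> (r, l) \<in> R)}"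

definition pres_cong :: "'b set \<Rightarrow> ('b list \<times> 'b list) set \<Rightarrow> ('b list \<times> 'b list) set" where
  "pres_cong B R = {(u, v). u \<in> lists B \<and> v \<in> lists B \<and> (u, v) \<in> (rel_step B R)\<^sup>*}"

definition presented_monoid :: "'b set \<Rightarrow> ('b list \<times> 'b list) set \<Rightarrow> 'b list set monoid" where
  "presented_monoid B R =
     \<lparr> carrier = lists B // pres_cong B R,
       monoid.mult = (\<lambda>X Y. \<Union>u\<in>X. \<Union>v\<in>Y. pres_cong B R `` {u @ v}),
       one = pres_cong B R `` {[]} \<rparr>"

definition defined_by ::
  "('a, 'm) monoid_scheme \<Rightarrow> 'b set \<Rightarrow> ('b list \<times> 'b list) set \<Rightarrow> bool" where
  "defined_by S B R \<longleftrightarrow> S \<cong> presented_monoid B R"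

text \<open>Up to renaming of letters, every finite alphabet is a finite set of natural numbers.\<close>

definition finitely_presented :: "('a, 'm) monoid_scheme \<Rightarrow> bool" where
  "finitely_presented S \<longleftrightarrow>
     (\<exists>(B :: nat set) R. finite_presentation B R \<and> defined_by S B R)"

text \<open>The area of a pair of words is only meaningful if the pair lies in \<^term>\<open>pres_cong B R\<close>.\<close>

definition word_area :: "'b set \<Rightarrow> ('b list \<times> 'b list) set \<Rightarrow> 'b list \<Rightarrow> 'b list \<Rightarrow> nat" where
  "word_area B R u v = (LEAST k. (u, v) \<in> rel_step B R ^^ k)"

definition pres_dehn :: "'b set \<Rightarrow> ('b list \<times> 'b list) set \<Rightarrow> nat \<Rightarrow> nat" where
  "pres_dehn B R n =
     Max {word_area B R u v | u v. (u, v) \<in> pres_cong B R \<and> length u + length v \<le> n}"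

text \<open>
  A path is a nonempty list of vertices, consecutive ones joined by an edge; the graphs have no
  multiple edges, so the vertices determine the path. Its length is \<^const>\<open>vwalk_length\<close>,
  the number of edges; the empty path at \<open>v\<close> is \<open>[v]\<close>; and \<^const>\<open>vwalk_join\<close> is
  concatenation of paths.
\<close>

definition is_path :: "'a pair_pre_digraph \<Rightarrow> 'a vwalk \<Rightarrow> bool" where
  "is_path G p \<longleftrightarrow> vwalk p (with_proj G)"

definition parallel :: "'a pair_pre_digraph \<Rightarrow> 'a vwalk \<Rightarrow> 'a vwalk \<Rightarrow> bool" where
  "parallel G p q \<longleftrightarrow> is_path G p \<and> is_path G q \<and> hd p = hd q \<and> last p = last q"

text \<open>
  A 2-cell is the pair of its top and its bottom path; the inverse of \<open>(p, q)\<close> is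
  \<open>(q, p)\<close>.
\<close>

type_synonym 'a cell = "'a vwalk \<times> 'a vwalk"

record 'a two_complex =
  skeleton :: "'a pair_pre_digraph"
  cells :: "'a cell set"

definition K :: "nat \<Rightarrow> 'a pair_pre_digraph \<Rightarrow> 'a two_complex" where
  "K n G =
     \<lparr> skeleton = G,
       cells = {(p, q). parallel G p q \<and> vwalk_length p + vwalk_length q \<le> n} \<rparr>"

type_synonym 'a atom = "'a vwalk \<times> 'a cell \<times> 'a vwalk"

definition atomic_2paths :: "'a two_complex \<Rightarrow> 'a atom set" where
  "atomic_2paths C =
     {(u, f, v). is_path (skeleton C) u \<and> f \<in> cells C \<and> is_path (skeleton C) v \<and>
        last u = hd (fst f) \<and> hd v = last (fst f)}"

fun atom_top :: "'a atom \<Rightarrow> 'a vwalk" where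
  "atom_top (u, (p, q), v) = vwalk_join u (vwalk_join p v)"

fun atom_bottom :: "'a atom \<Rightarrow> 'a vwalk" where
  "atom_bottom (u, (p, q), v) = vwalk_join u (vwalk_join q v)"

fun two_path :: "'a two_complex \<Rightarrow> 'a vwalk \<Rightarrow> 'a atom list \<Rightarrow> 'a vwalk \<Rightarrow> bool" where
  "two_path C p [] q \<longleftrightarrow> is_path (skeleton C) p \<and> p = q"
| "two_path C p (d # ds) q \<longleftrightarrow>
     d \<in> atomic_2paths C \<and> atom_top d = p \<and> two_path C (atom_bottom d) ds q"

definition directed_simply_connected :: "'a two_complex \<Rightarrow> bool" where
  "directed_simply_connected C \<longleftrightarrow>
     (\<forall>p q. parallel (skeleton C) p q \<longrightarrow> (\<exists>ds. two_path C p ds q))"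

definition n_quasi_simply_connected :: "nat \<Rightarrow> 'a pair_pre_digraph \<Rightarrow> bool" where
  "n_quasi_simply_connected n G \<longleftrightarrow> directed_simply_connected (K n G)"

definition quasi_simply_connected :: "'a pair_pre_digraph \<Rightarrow> bool" where
  "quasi_simply_connected G \<longleftrightarrow> (\<exists>n. n_quasi_simply_connected n G)"

text \<open>
  The next two notions are only meaningful for directed simply connected complexes.
\<close>

definition path_area :: "'a two_complex \<Rightarrow> 'a vwalk \<Rightarrow> 'a vwalk \<Rightarrow> nat" where
  "path_area C p q = (LEAST k. \<exists>ds. length ds = k \<and> two_path C p ds q)"

definition complex_dehn :: "'a two_complex \<Rightarrow> nat \<Rightarrow> enat" where
  "complex_dehn C i =
     Sup {enat (path_area C p q) | p q.
            parallel (skeleton C) p q \<and> vwalk_length p + vwalk_length q \<le> i}"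

definition dominated :: "(nat \<Rightarrow> enat) \<Rightarrow> (nat \<Rightarrow> enat) \<Rightarrow> bool" where
  "dominated f g \<longleftrightarrow>
     (\<exists>a :: nat. \<forall>j. f j \<le> enat a * g (a * j) + enat (a * j))"

definition same_type :: "(nat \<Rightarrow> enat) \<Rightarrow> (nat \<Rightarrow> enat) \<Rightarrow> bool" where
  "same_type f g \<longleftrightarrow> dominated f g \<and> dominated g f"

end

theory Submission
  imports Defs
begin

text \<open>
  Left cancellativity makes the edges leaving a vertex \<open>x\<close> of the Cayley graph correspond
  bijectively to the generators, and makes two paths leaving \<open>x\<close> parallel exactly when their
  label words represent the same element. Hence 2-paths in \<open>K n\<close> of the Cayley graph are
  derivations over the generators \<open>A\<close> from the finitely many relations of total length at most
  \<open>n\<close> that hold in \<open>S\<close>: this complex is directed simply connected iff these relations present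
  \<open>S\<close>, and its Dehn function is then exactly that of the presentation. What remains is the
  classical comparison of two finite presentations of a monoid, by translating words back and forth.
\<close>

section \<open>Derivations of bounded length\<close>

text \<open>Bounding the number of steps instead of fixing it makes the notion monotone in
  \<open>k\<close>, so bounds can be weakened, added, and made uniform over finite sets of words or
  relations.\<close>

definition steps_le ::
  "'b set \<Rightarrow> ('b list \<times> 'b list) set \<Rightarrow> nat \<Rightarrow> 'b list \<Rightarrow> 'b list \<Rightarrow> bool" where
  "steps_le B R k u v \<longleftrightarrow> (\<exists>i\<le>k. (u, v) \<in> rel_step B R ^^ i)"

lemma steps_leI: "(u, v) \<in> rel_step B R ^^ k \<Longrightarrow> steps_le B R k u v"
  by (auto simp: steps_le_def)

lemma steps_le_refl: "steps_le B R k u u"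
  by (auto simp: steps_le_def intro!: exI[of _ 0])

lemma steps_le_mono: "steps_le B R k u v \<Longrightarrow> k \<le> m \<Longrightarrow> steps_le B R m u v"
  by (auto simp: steps_le_def intro: order_trans)

lemma steps_le_trans:
  assumes "steps_le B R k u v" and "steps_le B R m v w"
  shows "steps_le B R (k + m) u w"
proof -
  obtain i j where "i \<le> k" "(u, v) \<in> rel_step B R ^^ i" "j \<le> m" "(v, w) \<in> rel_step B R ^^ j"
    using assms by (auto simp: steps_le_def)
  then show ?thesis
    unfolding steps_le_def by (intro exI[of _ "i + j"]) (auto simp: relpow_add)
qed

lemma rtrancl_iff_steps_le: "(u, v) \<in> (rel_step B R)\<^sup>* \<longleftrightarrow> (\<exists>k. steps_le B R k u v)"
  by (meson rtrancl_imp_relpow relpow_imp_rtrancl steps_le_def order_refl)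

lemma rel_stepI:
  "x \<in> lists B \<Longrightarrow> y \<in> lists B \<Longrightarrow> (l, r) \<in> R \<or> (r, l) \<in> R \<Longrightarrow>
    (x @ l @ y, x @ r @ y) \<in> rel_step B R"
  unfolding rel_step_def
  by (intro CollectI exI[of _ x] exI[of _ y] exI[of _ l] exI[of _ r] conjI refl)

lemma rel_stepE:
  assumes "(u, v) \<in> rel_step B R"
  obtains x y l r where "x \<in> lists B" "y \<in> lists B" "(l, r) \<in> R \<or> (r, l) \<in> R"
    "u = x @ l @ y" "v = x @ r @ y"
  using assms unfolding rel_step_def by blast

lemma sym_rel_step: "sym (rel_step B R)"
  by (rule symI, elim rel_stepE, simp only:) (rule rel_stepI, auto)

lemma sym_relpow: "sym r \<Longrightarrow> sym (r ^^ k)"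
proof (induction k)
  case (Suc k)
  show ?case
  proof (rule symI)
    fix x y assume "(x, y) \<in> r ^^ Suc k"
    then obtain z where "(x, z) \<in> r" "(z, y) \<in> r ^^ k" by (meson relpow_Suc_D2)
    then show "(y, x) \<in> r ^^ Suc k" using Suc by (auto dest: symD)
  qed
qed (auto simp: sym_def)

lemma steps_le_sym: "steps_le B R k u v \<Longrightarrow> steps_le B R k v u"
  unfolding steps_le_def by (meson sym_relpow[OF sym_rel_step, THEN symD])

lemma rel_step_in_context:
  assumes "(u, v) \<in> rel_step B R" "x \<in> lists B" "y \<in> lists B"
  shows "(x @ u @ y, x @ v @ y) \<in> rel_step B R"
proof -
  obtain x' y' l r where *: "x' \<in> lists B" "y' \<in> lists B" "(l, r) \<in> R \<or> (r, l) \<in> R"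
    "u = x' @ l @ y'" "v = x' @ r @ y'"
    using assms(1) by (rule rel_stepE)
  have "((x @ x') @ l @ (y' @ y), (x @ x') @ r @ (y' @ y)) \<in> rel_step B R"
    using * assms(2,3) by (intro rel_stepI) simp_all
  then show ?thesis using * by simp
qed

lemma steps_le_in_context:
  assumes "steps_le B R k u v" "x \<in> lists B" "y \<in> lists B"
  shows "steps_le B R k (x @ u @ y) (x @ v @ y)"
proof -
  have "(x @ u @ y, x @ v @ y) \<in> rel_step B R ^^ i" if "(u, v) \<in> rel_step B R ^^ i" for i
    using that
  proof (induction i arbitrary: v)
    case (Suc i)
    then obtain w where "(u, w) \<in> rel_step B R ^^ i" "(w, v) \<in> rel_step B R" by auto
    then show ?case using Suc.IH rel_step_in_context[OF _ assms(2,3)] by (blast intro: relpow_Suc_I)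
  qed simp
  then show ?thesis using assms(1) unfolding steps_le_def by blast
qed

text \<open>The left factor is rewritten first, with \<open>u'\<close> as right context, and then
  the right factor, with \<open>v\<close> as left context; hence only these two words must lie over
  \<open>B\<close>.\<close>

lemma steps_le_append:
  assumes "steps_le B R k u v" "steps_le B R m u' v'" "u' \<in> lists B" "v \<in> lists B"
  shows "steps_le B R (k + m) (u @ u') (v @ v')"
proof -
  have "steps_le B R k (u @ u') (v @ u')" "steps_le B R m (v @ u') (v @ v')"
    using steps_le_in_context[OF assms(1), of "[]" u'] steps_le_in_context[OF assms(2), of v "[]"]
      assms(3,4) by simp_all
  then show ?thesis by (rule steps_le_trans)
qed

lemma rel_step_lists:
  assumes "R \<subseteq> lists B \<times> lists B" "(u, v) \<in> rel_step B R"
  shows "u \<in> lists B" "v \<in> lists B"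
proof -
  obtain x y l r where *: "x \<in> lists B" "y \<in> lists B" "(l, r) \<in> R \<or> (r, l) \<in> R"
    "u = x @ l @ y" "v = x @ r @ y"
    using assms(2) by (rule rel_stepE)
  then have "l \<in> lists B" "r \<in> lists B" using assms(1) by auto
  then show "u \<in> lists B" "v \<in> lists B" using * by simp_all
qed

lemma relpow_rel_step_lists:
  assumes "R \<subseteq> lists B \<times> lists B" "(u, v) \<in> rel_step B R ^^ k" "u \<in> lists B"
  shows "v \<in> lists B"
proof (cases k)
  case 0
  then show ?thesis using assms(2,3) by simp
next
  case (Suc i)
  then obtain w where "(w, v) \<in> rel_step B R" using assms(2) by auto
  then show ?thesis by (rule rel_step_lists(2)[OF assms(1)])
qed

section \<open>Translating words\<close>

text \<open>The homomorphism of free monoids that extends \<open>f\<close>; it serves as the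
  translation of words between alphabets.\<close>

abbreviation subst :: "('b \<Rightarrow> 'c list) \<Rightarrow> 'b list \<Rightarrow> 'c list" where
  "subst f w \<equiv> concat (map f w)"

lemma subst_lists: "f \<in> B \<rightarrow> lists C \<Longrightarrow> w \<in> lists B \<Longrightarrow> subst f w \<in> lists C"
  by (induction w) auto

lemma subst_subst: "subst g (subst f w) = subst (\<lambda>b. subst g (f b)) w"
  by (induction w) auto

lemma length_subst_le:
  "w \<in> lists B \<Longrightarrow> \<forall>b\<in>B. length (f b) \<le> L \<Longrightarrow> length (subst f w) \<le> L * length w"
  by (induction w) (auto intro: add_mono)

text \<open>Used to compare a word with its round trip through another alphabet: each letter is
  replaced separately, at a cost of at most \<open>k\<close>, so the total cost is linear in the
  length.\<close>

lemma steps_le_subst_letters: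
  assumes "w \<in> lists B" "\<forall>b\<in>B. steps_le C Q k (f b) (g b)"
    "f \<in> B \<rightarrow> lists C" "g \<in> B \<rightarrow> lists C"
  shows "steps_le C Q (k * length w) (subst f w) (subst g w)"
  using assms(1)
proof (induction w)
  case (Cons b w)
  have "steps_le C Q (k + k * length w) (f b @ subst f w) (g b @ subst g w)"
    using Cons assms by (intro steps_le_append subst_lists[OF assms(3)]) auto
  then show ?case by simp
qed (simp add: steps_le_refl)

text \<open>A homomorphism sends the context of a step to a context, so it is enough to know the
  cost of deriving the image of a single relation; each step then contributes at most
  \<open>k\<close>.\<close>

lemma steps_le_subst:
  assumes "(u, v) \<in> rel_step B R ^^ i"
    "\<forall>(l, r)\<in>R. steps_le C Q k (subst f l) (subst f r)" "f \<in> B \<rightarrow> lists C"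
  shows "steps_le C Q (k * i) (subst f u) (subst f v)"
  using assms(1)
proof (induction i arbitrary: v)
  case (Suc i)
  then obtain w where w: "(u, w) \<in> rel_step B R ^^ i" "(w, v) \<in> rel_step B R" by auto
  obtain x y l r where *: "x \<in> lists B" "y \<in> lists B" "(l, r) \<in> R \<or> (r, l) \<in> R"
    "w = x @ l @ y" "v = x @ r @ y"
    using w(2) by (rule rel_stepE)
  have "steps_le C Q k (subst f l) (subst f r)"
    using *(3) assms(2) by (auto intro: steps_le_sym)
  then have "steps_le C Q k (subst f w) (subst f v)"
    using steps_le_in_context[OF _ subst_lists[OF assms(3) *(1)] subst_lists[OF assms(3) *(2)]]
    by (simp add: *(4,5))
  from steps_le_trans[OF Suc.IH[OF w(1)] this] show ?case by (simp add: add.commute)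
qed (simp add: steps_le_refl)

lemma finite_uniform_bound:
  assumes "finite X" "\<And>x. x \<in> X \<Longrightarrow> \<exists>k. P x k" "\<And>x k m. P x k \<Longrightarrow> k \<le> m \<Longrightarrow> P x m"
  obtains k :: nat where "\<forall>x\<in>X. P x k"
proof -
  obtain f where f: "\<forall>x\<in>X. P x (f x)" using assms(2) by metis
  \<comment> \<open>Each individual bound is a summand of \<open>sum f X\<close>, so monotonicity of
    \<open>P\<close> lifts it to this common bound.\<close>
  have "P x (sum f X)" if "x \<in> X" for x
    using assms(3) f that member_le_sum[of x X f] assms(1) by blast
  then show thesis using that by blast
qed

section \<open>Presentations with a named evaluation map\<close>

definition word_value :: "('a, 'm) monoid_scheme \<Rightarrow> ('b \<Rightarrow> 'a) \<Rightarrow> 'b list \<Rightarrow> 'a" where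
  "word_value S e w = foldr (\<lambda>b x. e b \<otimes>\<^bsub>S\<^esub> x) w \<one>\<^bsub>S\<^esub>"

text \<open>Whereas \<open>defined_by\<close> only asserts that some isomorphism exists, this fixes
  the values \<open>e\<close> of the letters: the induced homomorphism on words is onto the monoid,
  and its kernel is the congruence generated by \<open>R\<close>. Translations between presentations
  are built from such maps.\<close>

definition presents ::
  "('a, 'm) monoid_scheme \<Rightarrow> 'b set \<Rightarrow> ('b list \<times> 'b list) set \<Rightarrow> ('b \<Rightarrow> 'a) \<Rightarrow> bool" where
  "presents S B R e \<longleftrightarrow>
     e \<in> B \<rightarrow> carrier S \<and> carrier S \<subseteq> word_value S e ` lists B \<and>
     (\<forall>u\<in>lists B. \<forall>v\<in>lists B.
        word_value S e u = word_value S e v \<longleftrightarrow> (u, v) \<in> (rel_step B R)\<^sup>*)"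

lemma word_value_Nil [simp]: "word_value S e [] = \<one>\<^bsub>S\<^esub>"
  and word_value_Cons [simp]: "word_value S e (b # w) = e b \<otimes>\<^bsub>S\<^esub> word_value S e w"
  by (simp_all add: word_value_def)

context monoid
begin

lemma word_value_closed: "e \<in> B \<rightarrow> carrier G \<Longrightarrow> w \<in> lists B \<Longrightarrow> word_value G e w \<in> carrier G"
  by (induction w) auto

lemma word_value_append:
  assumes "e \<in> B \<rightarrow> carrier G" "u \<in> lists B" "v \<in> lists B"
  shows "word_value G e (u @ v) = word_value G e u \<otimes> word_value G e v"
  using assms(2)
proof (induction u)
  case (Cons b u)
  then show ?case using assms by (auto simp: m_assoc word_value_closed[OF assms(1)] Pi_iff)
qed (simp add: word_value_closed[OF assms(1,3)])

lemma word_value_subst: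
  assumes "e \<in> B \<rightarrow> carrier G" "f \<in> C \<rightarrow> lists B" "w \<in> lists C"
    "\<forall>c\<in>C. word_value G e (f c) = d c"
  shows "word_value G e (subst f w) = word_value G d w"
  using assms(3)
proof (induction w)
  case (Cons c w)
  then have "f c \<in> lists B" "subst f w \<in> lists B" using assms(2) subst_lists[OF assms(2)] by auto
  then show ?case using Cons assms(4) by (simp add: word_value_append[OF assms(1)])
qed simp

lemma word_value_rtrancl:
  assumes "e \<in> B \<rightarrow> carrier G" "R \<subseteq> lists B \<times> lists B"
    "\<forall>(l, r)\<in>R. word_value G e l = word_value G e r" "(u, v) \<in> (rel_step B R)\<^sup>*"
  shows "word_value G e u = word_value G e v"
  using assms(4)
proof (induction rule: rtrancl_induct)
  case (step v w)
  obtain x y l r where *: "x \<in> lists B" "y \<in> lists B" "(l, r) \<in> R \<or> (r, l) \<in> R"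
    "v = x @ l @ y" "w = x @ r @ y"
    using step(2) by (rule rel_stepE)
  have "l \<in> lists B" "r \<in> lists B" "word_value G e l = word_value G e r"
    using *(3) assms(2,3) by auto
  then have "word_value G e v = word_value G e w"
    using * by (simp add: word_value_append[OF assms(1)])
  with step show ?case by simp
qed simp

text \<open>Evaluation over \<open>B\<close> is onto, so every generator \<open>c\<close> can be
  assigned some word over \<open>B\<close> with the same value; \<open>subst f\<close> is then a
  value-preserving translation from \<open>C\<close> to \<open>B\<close>.\<close>

lemma presents_translation:
  assumes "presents G B R e" "d \<in> C \<rightarrow> carrier G"
  obtains f where "f \<in> C \<rightarrow> lists B" "\<forall>c\<in>C. word_value G e (f c) = d c"
proof -
  have "\<forall>c\<in>C. \<exists>w. w \<in> lists B \<and> word_value G e w = d c"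
    using assms unfolding presents_def by (fastforce simp: Pi_iff)
  then obtain f where "\<forall>c\<in>C. f c \<in> lists B \<and> word_value G e (f c) = d c"
    by metis
  then show thesis using that[of f] by auto
qed

end

lemma presents_pres_cong_iff:
  assumes "presents S B R e"
  shows "(u, v) \<in> pres_cong B R \<longleftrightarrow>
    u \<in> lists B \<and> v \<in> lists B \<and> word_value S e u = word_value S e v"
proof -
  have "word_value S e u = word_value S e v \<longleftrightarrow> (u, v) \<in> (rel_step B R)\<^sup>*"
    if "u \<in> lists B" "v \<in> lists B"
    using assms that by (simp only: presents_def)
  then show ?thesis unfolding pres_cong_def by blast
qed

lemma presents_imp_relations_hold:
  assumes "presents S B R e" "R \<subseteq> lists B \<times> lists B"
  shows "\<forall>(l, r)\<in>R. word_value S e l = word_value S e r"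
proof clarify
  fix l r assume lr: "(l, r) \<in> R"
  then have "(l, r) \<in> rel_step B R" using rel_stepI[of "[]" B "[]" l r R] by simp
  moreover have "l \<in> lists B" "r \<in> lists B" using lr assms(2) by auto
  ultimately have "(l, r) \<in> pres_cong B R" by (simp add: pres_cong_def r_into_rtrancl)
  then show "word_value S e l = word_value S e r"
    using presents_pres_cong_iff[OF assms(1)] by blast
qed

section \<open>The quotient monoid of a presentation and its evaluation maps\<close>

lemma equiv_pres_cong: "equiv (lists B) (pres_cong B R)"
proof (rule equivI)
  show "sym (pres_cong B R)"
    using sym_rtrancl[OF sym_rel_step[of B R]] by (auto simp: pres_cong_def sym_def)
qed (auto simp: pres_cong_def refl_on_def trans_def)

lemma pres_cong_append:
  assumes "(u, u') \<in> pres_cong B R" "(v, v') \<in> pres_cong B R"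
  shows "(u @ v, u' @ v') \<in> pres_cong B R"
proof -
  have *: "u \<in> lists B" "u' \<in> lists B" "v \<in> lists B" "v' \<in> lists B"
    using assms by (simp_all add: pres_cong_def)
  obtain k m where "steps_le B R k u u'" "steps_le B R m v v'"
    using assms by (auto simp: pres_cong_def rtrancl_iff_steps_le)
  then have "steps_le B R (k + m) (u @ v) (u' @ v')"
    using * by (intro steps_le_append)
  then show ?thesis using * unfolding pres_cong_def rtrancl_iff_steps_le by auto
qed

text \<open>Multiplication is defined as a union over all representatives of both factors;
  compatibility with concatenation makes all members of this union the same class.\<close>

lemma presented_mult_class:
  assumes "u \<in> lists B" "v \<in> lists B"
  shows "pres_cong B R `` {u} \<otimes>\<^bsub>presented_monoid B R\<^esub> pres_cong B R `` {v} =
    pres_cong B R `` {u @ v}"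
proof -
  let ?c = "\<lambda>w. pres_cong B R `` {w}"
  have *: "?c (u' @ v') = ?c (u @ v)" if "u' \<in> ?c u" "v' \<in> ?c v" for u' v'
    using pres_cong_append[of u u' B R v v'] equiv_class_eq[OF equiv_pres_cong] that
    by (metis Image_singleton_iff)
  \<comment> \<open>A union of a constant family equals that constant only over nonempty index
    sets.\<close>
  have ne: "u \<in> ?c u" "v \<in> ?c v"
    using assms by (auto simp: pres_cong_def)
  have "(\<Union>u'\<in>?c u. \<Union>v'\<in>?c v. ?c (u' @ v')) = (\<Union>u'\<in>?c u. \<Union>v'\<in>?c v. ?c (u @ v))"
    using * by (intro SUP_cong refl)
  also have "\<dots> = ?c (u @ v)" using ne by blast
  finally show ?thesis by (simp add: presented_monoid_def)
qed

text \<open>An isomorphism \<open>h\<close> yields \<open>e\<close> by pulling back the classes of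
  the one-letter words; conversely, \<open>e\<close> yields the isomorphism that sends
  \<open>x\<close> to the class of all words with value \<open>x\<close>.\<close>

lemma (in monoid) defined_by_iff_presents:
  "defined_by G B R \<longleftrightarrow> (\<exists>e. presents G B R e)"
proof
  let ?P = "presented_monoid B R" and ?c = "\<lambda>w. pres_cong B R `` {w}"
  assume "defined_by G B R"
  then obtain h where h: "h \<in> hom G ?P" "bij_betw h (carrier G) (carrier ?P)"
    unfolding defined_by_def is_iso_def iso_def by auto
  have car: "carrier ?P = ?c ` lists B"
    by (auto simp: presented_monoid_def quotient_def)
  have inv: "\<exists>x\<in>carrier G. h x = ?c w" if "w \<in> lists B" for w
  proof -
    have "?c w \<in> h ` carrier G" using h(2) car that by (simp add: bij_betw_def)
    then show ?thesis by auto
  qed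
  \<comment> \<open>Membership in \<open>hom\<close> demands only multiplicativity. Preservation of
    the identity comes from surjectivity: take \<open>x\<close> with \<open>h x\<close> the class of
    the empty word and evaluate \<open>h (\<one> \<otimes> x)\<close> in two ways.\<close>
  have h1: "h \<one> = ?c []"
  proof -
    obtain x where x: "x \<in> carrier G" "h x = ?c []" using inv[of "[]"] by auto
    have "h \<one> \<in> carrier ?P" using bij_betwE[OF h(2)] one_closed by blast
    then obtain u where u: "u \<in> lists B" "h \<one> = ?c u" unfolding car by blast
    have "h (\<one> \<otimes> x) = ?c u \<otimes>\<^bsub>?P\<^esub> ?c []"
      using hom_mult[OF h(1) one_closed x(1)] unfolding x(2) u(2) .
    also have "\<dots> = ?c (u @ [])" by (rule presented_mult_class[OF u(1)]) simp
    finally show ?thesis using x(1) unfolding u(2) l_one[OF x(1)] x(2) by simp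
  qed
  have "\<forall>b\<in>B. \<exists>x\<in>carrier G. h x = ?c [b]" using inv by simp
  then obtain e where e: "\<forall>b\<in>B. e b \<in> carrier G \<and> h (e b) = ?c [b]" by metis
  then have eB: "e \<in> B \<rightarrow> carrier G" by auto
  have hw: "h (word_value G e w) = ?c w" if "w \<in> lists B" for w
    using that
  proof (induction w)
    case (Cons b w)
    then have "h (word_value G e (b # w)) = h (e b) \<otimes>\<^bsub>?P\<^esub> h (word_value G e w)"
      using hom_mult[OF h(1), of "e b" "word_value G e w"] e word_value_closed[OF eB] by auto
    then show ?case using Cons e presented_mult_class[of "[b]" B w R] by simp
  qed (simp add: h1)
  have inj: "inj_on h (carrier G)" using h(2) by (simp add: bij_betw_def)
  have "presents G B R e"
    unfolding presents_def
  proof (intro conjI ballI subsetI)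
    fix x assume x: "x \<in> carrier G"
    then have "h x \<in> carrier ?P" using bij_betwE[OF h(2)] by blast
    then obtain w where w: "w \<in> lists B" "h x = ?c w" unfolding car by blast
    then have "x = word_value G e w"
      using inj_onD[OF inj _ x word_value_closed[OF eB w(1)]] hw[OF w(1)] by simp
    then show "x \<in> word_value G e ` lists B" using w(1) by blast
  next
    fix u v assume uv: "u \<in> lists B" "v \<in> lists B"
    have "word_value G e u = word_value G e v \<longleftrightarrow> ?c u = ?c v"
      using inj_on_eq_iff[OF inj word_value_closed[OF eB uv(1)] word_value_closed[OF eB uv(2)]]
      by (simp only: hw[OF uv(1)] hw[OF uv(2)])
    also have "\<dots> \<longleftrightarrow> (u, v) \<in> pres_cong B R"
      using eq_equiv_class_iff[OF equiv_pres_cong uv] by simp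
    finally show "word_value G e u = word_value G e v \<longleftrightarrow> (u, v) \<in> (rel_step B R)\<^sup>*"
      using uv by (simp add: pres_cong_def)
  qed (use eB in auto)
  then show "\<exists>e. presents G B R e" by blast
next
  let ?P = "presented_monoid B R" and ?c = "\<lambda>w. pres_cong B R `` {w}"
  assume "\<exists>e. presents G B R e"
  then obtain e where e: "presents G B R e" by blast
  have eB: "e \<in> B \<rightarrow> carrier G" using e by (simp add: presents_def)
  \<comment> \<open>The fibre of the evaluation map over an element is a whole congruence class, so
    no representative has to be chosen.\<close>
  define h where "h x = {w \<in> lists B. word_value G e w = x}" for x
  have hw: "h (word_value G e w) = ?c w" if "w \<in> lists B" for w
    using that by (auto simp: h_def presents_pres_cong_iff[OF e])
  have rep: "\<exists>w\<in>lists B. x = word_value G e w" if "x \<in> carrier G" for x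
    using e that unfolding presents_def by auto
  have car: "carrier ?P = ?c ` lists B"
    by (auto simp: presented_monoid_def quotient_def)
  have "h \<in> hom G ?P"
  proof (rule homI)
    fix x assume "x \<in> carrier G"
    then show "h x \<in> carrier ?P" using rep[of x] hw car by auto
  next
    fix x y assume "x \<in> carrier G" "y \<in> carrier G"
    then obtain u v where u: "u \<in> lists B" "x = word_value G e u"
      and v: "v \<in> lists B" "y = word_value G e v"
      using rep by meson
    then have "h (x \<otimes> y) = ?c (u @ v)"
      using hw[of "u @ v"] word_value_append[OF eB u(1) v(1)] by simp
    also have "\<dots> = h x \<otimes>\<^bsub>?P\<^esub> h y"
      using hw[OF u(1)] hw[OF v(1)] presented_mult_class[OF u(1) v(1), of R] u(2) v(2) by simp
    finally show "h (x \<otimes> y) = h x \<otimes>\<^bsub>?P\<^esub> h y" .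
  qed
  moreover have "bij_betw h (carrier G) (carrier ?P)"
  proof (rule bij_betw_imageI)
    show "inj_on h (carrier G)"
    proof (rule inj_onI)
      fix x y assume "x \<in> carrier G" "y \<in> carrier G" "h x = h y"
      moreover obtain w where "w \<in> lists B" "x = word_value G e w"
        using rep[OF \<open>x \<in> carrier G\<close>] by auto
      ultimately show "x = y" unfolding h_def by blast
    qed
    have "carrier G = word_value G e ` lists B"
      using rep word_value_closed[OF eB] by blast
    then show "h ` carrier G = carrier ?P" using hw car by (simp add: image_image)
  qed
  ultimately show "defined_by G B R" unfolding defined_by_def is_iso_def iso_def by auto
qed

section \<open>Dehn functions of finite presentations\<close>

lemma relpow_word_area:
  assumes "(u, v) \<in> pres_cong B R"
  shows "(u, v) \<in> rel_step B R ^^ word_area B R u v"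
proof -
  have "\<exists>k. (u, v) \<in> rel_step B R ^^ k"
    using assms by (intro rtrancl_imp_relpow) (simp add: pres_cong_def)
  then show ?thesis unfolding word_area_def by (rule LeastI_ex)
qed

lemma word_area_le: "steps_le B R k u v \<Longrightarrow> word_area B R u v \<le> k"
  unfolding word_area_def steps_le_def by (meson Least_le order_trans)

text \<open>A finite alphabet admits only finitely many words of bounded length. Together with
  nonemptiness this makes the \<open>Max\<close> in \<open>pres_dehn\<close> a genuine
  maximum.\<close>

lemma finite_areas:
  assumes "finite B"
  shows "finite {word_area B R u v | u v. (u, v) \<in> pres_cong B R \<and> length u + length v \<le> n}"
proof -
  let ?W = "{w. set w \<subseteq> B \<and> length w \<le> n}"
  have "{word_area B R u v | u v. (u, v) \<in> pres_cong B R \<and> length u + length v \<le> n}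
    \<subseteq> (\<lambda>(u, v). word_area B R u v) ` (?W \<times> ?W)"
    by (fastforce simp: pres_cong_def)
  then show ?thesis
    using finite_lists_length_le[OF assms, of n] by (meson finite_SigmaI finite_imageI finite_subset)
qed

lemma areas_nonempty:
  "{word_area B R u v | u v. (u, v) \<in> pres_cong B R \<and> length u + length v \<le> n} \<noteq> {}"
proof -
  have "([], []) \<in> pres_cong B R \<and> length [] + length [] \<le> n" by (simp add: pres_cong_def)
  then show ?thesis by blast
qed

lemma word_area_le_pres_dehn:
  assumes "finite B" "(u, v) \<in> pres_cong B R" "length u + length v \<le> n"
  shows "word_area B R u v \<le> pres_dehn B R n"
  unfolding pres_dehn_def using assms by (intro Max_ge finite_areas) auto

lemma pres_dehn_le:
  assumes "finite B"
    "\<And>u v. (u, v) \<in> pres_cong B R \<Longrightarrow> length u + length v \<le> n \<Longrightarrow> word_area B R u v \<le> m"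
  shows "pres_dehn B R n \<le> m"
proof -
  have "pres_dehn B R n
      \<in> {word_area B R u v | u v. (u, v) \<in> pres_cong B R \<and> length u + length v \<le> n}"
    unfolding pres_dehn_def by (rule Max_in[OF finite_areas[OF assms(1)] areas_nonempty])
  then show ?thesis using assms(2) by auto
qed

text \<open>A congruent pair over \<open>B\<close> is translated to \<open>C\<close>, joined there
  by a shortest derivation, and this derivation is translated back to \<open>B\<close>. It joins the
  round trips of the two original words, and each word is joined to its own round trip at linear
  cost.\<close>

lemma (in monoid) pres_dehn_dominated:
  fixes B :: "'c set" and C :: "'d set"
  assumes B: "finite_presentation B R" "presents G B R e"
    and C: "finite_presentation C Q" "presents G C Q d"
  shows "dominated (\<lambda>i. enat (pres_dehn B R i)) (\<lambda>i. enat (pres_dehn C Q i))"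
proof -
  have fin: "finite B" "finite C" "finite Q" "Q \<subseteq> lists C \<times> lists C"
    using B(1) C(1) by (auto simp: finite_presentation_def)
  have eB: "e \<in> B \<rightarrow> carrier G" and dC: "d \<in> C \<rightarrow> carrier G"
    using B(2) C(2) by (auto simp: presents_def)
  obtain f where f: "f \<in> B \<rightarrow> lists C" "\<forall>b\<in>B. word_value G d (f b) = e b"
    using presents_translation[OF C(2) eB] .
  obtain g where g: "g \<in> C \<rightarrow> lists B" "\<forall>c\<in>C. word_value G e (g c) = d c"
    using presents_translation[OF B(2) dC] .
  have connected: "\<exists>k. steps_le B R k u v"
    if "u \<in> lists B" "v \<in> lists B" "word_value G e u = word_value G e v" for u v
    using B(2) that rtrancl_iff_steps_le[of u v B R] unfolding presents_def by auto
  obtain L where L: "\<forall>b\<in>B. length (f b) \<le> L"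
    by (rule finite_uniform_bound[of B "\<lambda>b k. length (f b) \<le> k"]) (use fin in auto)
  \<comment> \<open>The relations of \<open>Q\<close> hold in the monoid, so their translations are
    derivable from \<open>R\<close>; finiteness of \<open>Q\<close> then gives one bound
    \<open>M\<close> for all of them.\<close>
  have "\<exists>k. steps_le B R k (subst g (fst p)) (subst g (snd p))" if "p \<in> Q" for p
  proof (rule connected)
    have p: "fst p \<in> lists C" "snd p \<in> lists C" using that fin by auto
    then show "subst g (fst p) \<in> lists B" "subst g (snd p) \<in> lists B"
      using subst_lists[OF g(1)] by blast+
    show "word_value G e (subst g (fst p)) = word_value G e (subst g (snd p))"
      using presents_imp_relations_hold[OF C(2) fin(4)] that
        word_value_subst[OF eB g(1) p(1) g(2)] word_value_subst[OF eB g(1) p(2) g(2)]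
      by (auto split: prod.splits)
  qed
  then obtain M where M: "\<forall>p\<in>Q. steps_le B R M (subst g (fst p)) (subst g (snd p))"
    using finite_uniform_bound[of Q "\<lambda>p k. steps_le B R k (subst g (fst p)) (subst g (snd p))"]
      fin(3) steps_le_mono by blast
  have gf: "subst g (f b) \<in> lists B" "word_value G e (subst g (f b)) = e b" if "b \<in> B" for b
  proof -
    have "f b \<in> lists C" using f(1) that by blast
    then show "subst g (f b) \<in> lists B" "word_value G e (subst g (f b)) = e b"
      using subst_lists[OF g(1)] word_value_subst[OF eB g(1) _ g(2)] f(2) that by simp_all
  qed
  have "\<exists>k. steps_le B R k [b] (subst g (f b))" if "b \<in> B" for b
  proof (rule connected)
    have "e b \<in> carrier G" using eB that by blast
    then show "word_value G e [b] = word_value G e (subst g (f b))" using gf[OF that] by simp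
  qed (use that gf in auto)
  then obtain N where N: "\<forall>b\<in>B. steps_le B R N [b] (subst g (f b))"
    using finite_uniform_bound[of B "\<lambda>b k. steps_le B R k [b] (subst g (f b))"]
      fin(1) steps_le_mono by blast
  \<comment> \<open>\<open>L\<close> stretches the argument of the Dehn function, \<open>M\<close>
    is the cost of one translated relation and hence the outer factor, and \<open>N\<close> is the
    cost of the round trip of one letter and hence the linear term. Their sum dominates each of
    them.\<close>
  define a where "a = L + M + N"
  have "pres_dehn B R j \<le> a * pres_dehn C Q (a * j) + a * j" for j
  proof (rule pres_dehn_le[OF fin(1)])
    fix u v assume uv: "(u, v) \<in> pres_cong B R" and len: "length u + length v \<le> j"
    have uB: "u \<in> lists B" and vB: "v \<in> lists B" using uv by (auto simp: pres_cong_def)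
    let ?u = "subst f u" and ?v = "subst f v"
    have fuv: "?u \<in> lists C" "?v \<in> lists C"
      using subst_lists[OF f(1)] uB vB by auto
    have "word_value G e u = word_value G e v"
      using uv presents_pres_cong_iff[OF B(2)] by blast
    then have "word_value G d ?u = word_value G d ?v"
      using word_value_subst[OF dC f(1) uB f(2)] word_value_subst[OF dC f(1) vB f(2)] by simp
    then have fc: "(?u, ?v) \<in> pres_cong C Q"
      using fuv presents_pres_cong_iff[OF C(2)] by blast
    have "length ?u + length ?v \<le> L * (length u + length v)"
      using length_subst_le[OF uB L] length_subst_le[OF vB L] by (simp add: algebra_simps)
    also have "\<dots> \<le> a * j" using len by (intro mult_mono) (auto simp: a_def)
    finally have area: "word_area C Q ?u ?v \<le> pres_dehn C Q (a * j)"
      by (rule word_area_le_pres_dehn[OF fin(2) fc])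
    have "steps_le B R (M * word_area C Q ?u ?v) (subst g ?u) (subst g ?v)"
      using steps_le_subst[OF relpow_word_area[OF fc] _ g(1)] M by (auto simp: split_beta)
    then have mid: "steps_le B R (a * pres_dehn C Q (a * j)) (subst g ?u) (subst g ?v)"
      by (rule steps_le_mono) (use area in \<open>auto intro!: mult_mono simp: a_def\<close>)
    \<comment> \<open>The word \<open>w\<close> is its own image under the substitution of
      \<open>[b]\<close> for \<open>b\<close>, so the letterwise comparison applies.\<close>
    have expand: "steps_le B R (N * length w) w (subst g (subst f w))" if "w \<in> lists B" for w
      using steps_le_subst_letters[OF that N] gf by (auto simp: subst_subst)
    have "steps_le B R (N * length u + a * pres_dehn C Q (a * j) + N * length v) u v"
      by (rule steps_le_trans[OF steps_le_trans[OF expand[OF uB] mid]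
            steps_le_sym[OF expand[OF vB]]])
    then have "word_area B R u v \<le> N * length u + a * pres_dehn C Q (a * j) + N * length v"
      by (rule word_area_le)
    also have "\<dots> = a * pres_dehn C Q (a * j) + N * (length u + length v)"
      by (simp add: algebra_simps)
    also have "\<dots> \<le> a * pres_dehn C Q (a * j) + a * j"
      using len by (intro add_left_mono mult_mono) (auto simp: a_def)
    finally show "word_area B R u v \<le> a * pres_dehn C Q (a * j) + a * j" .
  qed
  then show ?thesis unfolding dominated_def by (intro exI[of _ a]) simp
qed

section \<open>Paths in the Cayley graph as words\<close>

text \<open>The pairs of words labelling the 2-cells of \<open>K n\<close>, without their base
  vertex. By left cancellativity, the same pairs occur at every vertex.\<close>

definition cell_relations ::
  "('a, 'm) monoid_scheme \<Rightarrow> 'a set \<Rightarrow> nat \<Rightarrow> ('a list \<times> 'a list) set" where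
  "cell_relations S A n =
     {(u, v). u \<in> lists A \<and> v \<in> lists A \<and> word_value S (\<lambda>a. a) u = word_value S (\<lambda>a. a) v \<and>
        length u + length v \<le> n}"

fun walk :: "('a, 'm) monoid_scheme \<Rightarrow> 'a \<Rightarrow> 'a list \<Rightarrow> 'a vwalk" where
  "walk S x [] = [x]"
| "walk S x (a # w) = x # walk S (x \<otimes>\<^bsub>S\<^esub> a) w"

lemma finite_presentation_cell_relations:
  assumes "finite A"
  shows "finite_presentation A (cell_relations S A n)"
proof -
  let ?W = "{w. set w \<subseteq> A \<and> length w \<le> n}"
  have "cell_relations S A n \<subseteq> ?W \<times> ?W" by (fastforce simp: cell_relations_def)
  then have "finite (cell_relations S A n)"
    using finite_lists_length_le[OF assms, of n] by (meson finite_SigmaI finite_subset)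
  then show ?thesis using assms by (auto simp: finite_presentation_def cell_relations_def)
qed

lemma walk_nonempty [simp]: "walk S x w \<noteq> []" "[] \<noteq> walk S x w"
  and hd_walk [simp]: "hd (walk S x w) = x"
  and length_walk [simp]: "length (walk S x w) = Suc (length w)"
  by (induction w arbitrary: x) auto

text \<open>The values of words over \<open>A\<close> form a submonoid containing \<open>A\<close>,
  and \<open>generated_by\<close> forces any such submonoid to be everything.\<close>

lemma generated_by_word_value:
  assumes "monoid S" "generated_by S A"
  shows "carrier S \<subseteq> word_value S (\<lambda>a. a) ` lists A"
proof -
  interpret monoid S by fact
  have A: "(\<lambda>a. a) \<in> A \<rightarrow> carrier S" using assms(2) by (auto simp: generated_by_def)
  have "submonoid (word_value S (\<lambda>a. a) ` lists A) S"
  proof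
    fix x y assume "x \<in> word_value S (\<lambda>a. a) ` lists A" "y \<in> word_value S (\<lambda>a. a) ` lists A"
    then obtain u v where "u \<in> lists A" "v \<in> lists A" "x = word_value S (\<lambda>a. a) u" "y = word_value S (\<lambda>a. a) v"
      by auto
    then have "x \<otimes>\<^bsub>S\<^esub> y = word_value S (\<lambda>a. a) (u @ v)" "u @ v \<in> lists A"
      using word_value_append[OF A] by auto
    then show "x \<otimes>\<^bsub>S\<^esub> y \<in> word_value S (\<lambda>a. a) ` lists A" by blast
  next
    have "\<one>\<^bsub>S\<^esub> = word_value S (\<lambda>a. a) []" by simp
    then show "\<one>\<^bsub>S\<^esub> \<in> word_value S (\<lambda>a. a) ` lists A" by blast
  qed (use word_value_closed[OF A] in auto)
  moreover have "A \<subseteq> word_value S (\<lambda>a. a) ` lists A"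
  proof
    fix a assume "a \<in> A"
    then have "a = word_value S (\<lambda>a. a) [a]" "[a] \<in> lists A"
      using assms(2) by (auto simp: generated_by_def)
    then show "a \<in> word_value S (\<lambda>a. a) ` lists A" by blast
  qed
  ultimately show ?thesis using assms(2) by (auto simp: generated_by_def)
qed

locale left_cancellative_generated = monoid G for G :: "('a, 'm) monoid_scheme" (structure) +
  fixes A :: "'a set"
  assumes lc: "left_cancellative G"
    and finite_A: "finite A"
    and gen: "generated_by G A"
begin

abbreviation "val \<equiv> word_value G (\<lambda>a. a)"
abbreviation "path \<equiv> walk G"
abbreviation "cgraph \<equiv> cayley_graph G A"
abbreviation "rels \<equiv> cell_relations G A"

lemma A_Pi: "(\<lambda>a. a) \<in> A \<rightarrow> carrier G"
  using gen by (auto simp: generated_by_def)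

lemma A_closed: "a \<in> A \<Longrightarrow> a \<in> carrier G"
  using A_Pi by auto

lemmas val_closed = word_value_closed[OF A_Pi]

lemma cancel: "x \<in> carrier G \<Longrightarrow> y \<in> carrier G \<Longrightarrow> z \<in> carrier G \<Longrightarrow> x \<otimes> y = x \<otimes> z \<longleftrightarrow> y = z"
  using lc unfolding left_cancellative_def by blast

lemma rels_lists: "rels n \<subseteq> lists A \<times> lists A"
  by (auto simp: cell_relations_def)

lemma rels_sound: "\<forall>(l, r)\<in>rels n. val l = val r"
  by (auto simp: cell_relations_def)

lemma last_walk: "x \<in> carrier G \<Longrightarrow> w \<in> lists A \<Longrightarrow> last (path x w) = x \<otimes> val w"
proof (induction w arbitrary: x)
  case (Cons a w)
  then show ?case using A_closed val_closed by (auto simp: m_assoc)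
qed simp

lemma walk_append:
  "x \<in> carrier G \<Longrightarrow> u \<in> lists A \<Longrightarrow>
    path x (u @ v) = vwalk_join (path x u) (path (x \<otimes> val u) v)"
proof (induction u arbitrary: x)
  case Nil
  then show ?case by (cases v) (auto simp: vwalk_join_def)
next
  case (Cons a u)
  then show ?case using A_closed val_closed by (auto simp: vwalk_join_def m_assoc)
qed

text \<open>Left cancellativity enters here: the first two vertices \<open>x\<close> and
  \<open>x \<otimes> a\<close> determine \<open>a\<close>, so a list of vertices determines its
  label word.\<close>

lemma walk_inject:
  "x \<in> carrier G \<Longrightarrow> u \<in> lists A \<Longrightarrow> v \<in> lists A \<Longrightarrow> path x u = path y v \<longleftrightarrow> x = y \<and> u = v"
proof (induction u arbitrary: x y v)
  case Nil
  then show ?case by (cases v) auto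
next
  case (Cons a u)
  show ?case
  proof (cases v)
    case (Cons b v')
    then show ?thesis
      using Cons.IH[of "x \<otimes> a" v' "y \<otimes> b"] Cons.prems A_closed cancel[of x a b] by auto
  qed simp
qed

lemma is_path_walk: "x \<in> carrier G \<Longrightarrow> w \<in> lists A \<Longrightarrow> is_path cgraph (path x w)"
proof (induction w arbitrary: x)
  case Nil
  then show ?case by (simp add: is_path_def vwalk_def cayley_graph_def)
next
  case (Cons a w)
  then have "is_path cgraph (path (x \<otimes> a) w)" using A_closed by auto
  then show ?case
    using Cons A_closed by (auto simp: is_path_def cayley_graph_def intro!: vwalk_consI)
qed

text \<open>Each edge of the Cayley graph comes from some generator; collecting these along the path
  spells a label word.\<close>

lemma is_pathE:
  assumes "is_path cgraph p"
  obtains x w where "x \<in> carrier G" "w \<in> lists A" "p = path x w"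
proof -
  have "\<exists>w\<in>lists A. p = path (hd p) w \<and> hd p \<in> carrier G"
    using assms[unfolded is_path_def]
  proof (induction p rule: vwalk_induct)
    case (Base u)
    then show ?case by (auto intro!: bexI[of _ "[]"] simp: cayley_graph_def)
  next
    case (Cons u v es)
    then obtain w a where w: "w \<in> lists A" "v # es = path v w" "a \<in> A" "u \<otimes> a = v"
      and u: "u \<in> carrier G"
      by (auto simp: cayley_graph_def)
    then show ?case by (auto intro!: bexI[of _ "a # w"])
  qed
  then show thesis using that by auto
qed

text \<open>From a common start \<open>x\<close> the ends are \<open>x \<otimes> val u\<close> and
  \<open>x \<otimes> val v\<close>. Cancelling \<open>x\<close> makes the condition on the labels
  independent of the base vertex.\<close>

lemma parallel_walk_iff:
  assumes "x \<in> carrier G" "y \<in> carrier G" "u \<in> lists A" "v \<in> lists A"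
  shows "parallel cgraph (path x u) (path y v) \<longleftrightarrow> x = y \<and> val u = val v"
proof -
  have "x \<otimes> val u = x \<otimes> val v \<longleftrightarrow> val u = val v"
    by (rule cancel[OF assms(1) val_closed[OF assms(3)] val_closed[OF assms(4)]])
  then show ?thesis using assms by (auto simp: parallel_def is_path_walk last_walk)
qed

lemma parallelE:
  assumes "parallel cgraph p q"
  obtains x u v where "x \<in> carrier G" "u \<in> lists A" "v \<in> lists A" "val u = val v"
    "p = path x u" "q = path x v"
proof -
  obtain x u y v where *: "x \<in> carrier G" "u \<in> lists A" "p = path x u"
    "y \<in> carrier G" "v \<in> lists A" "q = path y v"
    using assms unfolding parallel_def by (meson is_pathE)
  then show thesis using that[of x u v] assms parallel_walk_iff[of x y u v] by auto
qed

section \<open>2-paths in the complex as derivations over the generators\<close>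

lemma atom_imp_rel_step:
  assumes "d \<in> atomic_2paths (K n cgraph)" "atom_top d = path x u" "x \<in> carrier G" "u \<in> lists A"
  shows "\<exists>v. atom_bottom d = path x v \<and> (u, v) \<in> rel_step A (rels n)"
proof -
  obtain s p q t where d: "d = (s, (p, q), t)" by (metis prod.exhaust)
  have *: "is_path cgraph s" "parallel cgraph p q" "vwalk_length p + vwalk_length q \<le> n"
    "is_path cgraph t" "last s = hd p" "hd t = last p"
    using assms(1) by (auto simp: d atomic_2paths_def K_def)
  obtain x' a where s: "x' \<in> carrier G" "a \<in> lists A" "s = path x' a" using is_pathE[OF *(1)] .
  obtain z b where t: "z \<in> carrier G" "b \<in> lists A" "t = path z b" using is_pathE[OF *(4)] .
  obtain y l r where pq: "y \<in> carrier G" "l \<in> lists A" "r \<in> lists A" "val l = val r"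
    "p = path y l" "q = path y r"
    using parallelE[OF *(2)] .
  \<comment> \<open>The gluing conditions of the atom locate its cell and its final segment along
    the path.\<close>
  have y: "y = x' \<otimes> val a" and z: "z = y \<otimes> val l"
    using *(5,6) s t pq by (auto simp: last_walk)
  have lr: "(l, r) \<in> rels n" using pq *(3) by (auto simp: cell_relations_def)
  have top: "atom_top d = path x' (a @ l @ b)"
    using s t pq y z by (simp add: d walk_append)
  \<comment> \<open>Since \<open>val l = val r\<close>, the path \<open>q\<close> also ends at
    \<open>z\<close>, where the final segment \<open>t\<close> begins.\<close>
  have bot: "atom_bottom d = path x' (a @ r @ b)"
    using s t pq y z by (simp add: d walk_append)
  have "x' = x" "u = a @ l @ b"
    using top assms(2-4) walk_inject[of x u "a @ l @ b" x'] s t pq by auto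
  then show ?thesis using bot rel_stepI[OF s(2) t(2) disjI1[OF lr]] by auto
qed

lemma rel_step_imp_atom:
  assumes "(u, v) \<in> rel_step A (rels n)" "x \<in> carrier G"
  shows "\<exists>d\<in>atomic_2paths (K n cgraph). atom_top d = path x u \<and> atom_bottom d = path x v"
proof -
  obtain a b l r where *: "a \<in> lists A" "b \<in> lists A" "(l, r) \<in> rels n \<or> (r, l) \<in> rels n"
    "u = a @ l @ b" "v = a @ r @ b"
    using assms(1) by (rule rel_stepE)
  \<comment> \<open>\<open>rels n\<close> is symmetric, so the direction in which the relation is
    applied makes no difference.\<close>
  have lr: "l \<in> lists A" "r \<in> lists A" "val l = val r" "length l + length r \<le> n"
    using *(3) by (auto simp: cell_relations_def)
  define y where "y = x \<otimes> val a"
  define z where "z = y \<otimes> val l"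
  have yz: "y \<in> carrier G" "z \<in> carrier G"
    using assms(2) * lr val_closed by (auto simp: y_def z_def)
  let ?d = "(path x a, (path y l, path y r), path z b)"
  have "parallel cgraph (path y l) (path y r)"
    using parallel_walk_iff[OF yz(1) yz(1) lr(1,2)] lr(3) by simp
  moreover have "last (path x a) = y" "last (path y l) = z"
    using last_walk[OF assms(2) *(1)] last_walk[OF yz(1) lr(1)] by (simp_all only: y_def z_def)
  ultimately have "?d \<in> atomic_2paths (K n cgraph)"
    using * lr yz assms(2) by (simp add: atomic_2paths_def K_def is_path_walk)
  moreover have "path x (a @ w) = vwalk_join (path x a) (path y w)"
    "path y (l @ b) = vwalk_join (path y l) (path z b)"
    "path y (r @ b) = vwalk_join (path y r) (path z b)" for w
    using walk_append[OF assms(2) *(1)] walk_append[OF yz(1) lr(1)] walk_append[OF yz(1) lr(2)]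
    by (simp_all only: y_def z_def lr(3))
  then have "atom_top ?d = path x u" "atom_bottom ?d = path x v"
    using * by simp_all
  ultimately show ?thesis by blast
qed

text \<open>The end \<open>q\<close> is left arbitrary because it is part of the induction that a
  2-path keeps the base vertex \<open>x\<close> and again ends at a path spelled by a word. Lengths
  match exactly, one atom per step, which later identifies the areas.\<close>

lemma two_path_iff_relpow:
  assumes "x \<in> carrier G" "u \<in> lists A"
  shows "(\<exists>ds. length ds = k \<and> two_path (K n cgraph) (path x u) ds q) \<longleftrightarrow>
    (\<exists>v. q = path x v \<and> (u, v) \<in> rel_step A (rels n) ^^ k)"
  using assms(2)
proof (induction k arbitrary: u)
  case 0
  then show ?case using is_path_walk[OF assms(1)] by (auto simp: K_def)
next
  case (Suc k)
  show ?case
  proof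
    assume "\<exists>ds. length ds = Suc k \<and> two_path (K n cgraph) (path x u) ds q"
    then obtain d ds where d: "length ds = k" "d \<in> atomic_2paths (K n cgraph)"
      "atom_top d = path x u" "two_path (K n cgraph) (atom_bottom d) ds q"
      by (auto simp: length_Suc_conv)
    obtain w where w: "atom_bottom d = path x w" "(u, w) \<in> rel_step A (rels n)"
      using atom_imp_rel_step[OF d(2,3) assms(1) Suc.prems] by auto
    obtain v where "q = path x v" "(w, v) \<in> rel_step A (rels n) ^^ k"
      using Suc.IH[OF rel_step_lists(2)[OF rels_lists w(2)]] d w by auto
    then show "\<exists>v. q = path x v \<and> (u, v) \<in> rel_step A (rels n) ^^ Suc k"
      using w(2) relpow_Suc_I2 by metis
  next
    assume "\<exists>v. q = path x v \<and> (u, v) \<in> rel_step A (rels n) ^^ Suc k"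
    then obtain v where "q = path x v" "(u, v) \<in> rel_step A (rels n) ^^ Suc k" by blast
    then obtain w where v: "q = path x v" "(u, w) \<in> rel_step A (rels n)"
      "(w, v) \<in> rel_step A (rels n) ^^ k"
      by (meson relpow_Suc_D2)
    obtain ds where "length ds = k" "two_path (K n cgraph) (path x w) ds q"
      using Suc.IH[OF rel_step_lists(2)[OF rels_lists v(2)]] v by auto
    moreover obtain d where "d \<in> atomic_2paths (K n cgraph)" "atom_top d = path x u"
      "atom_bottom d = path x w"
      using rel_step_imp_atom[OF v(2) assms(1)] by auto
    ultimately show "\<exists>ds. length ds = Suc k \<and> two_path (K n cgraph) (path x u) ds q"
      by (intro exI[of _ "d # ds"]) simp
  qed
qed

lemma two_path_walk_iff:
  assumes "x \<in> carrier G" "u \<in> lists A" "v \<in> lists A"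
  shows "(\<exists>ds. length ds = k \<and> two_path (K n cgraph) (path x u) ds (path x v)) \<longleftrightarrow>
    (u, v) \<in> rel_step A (rels n) ^^ k"
proof -
  have "v' = v" if "path x v = path x v'" "(u, v') \<in> rel_step A (rels n) ^^ k" for v'
  proof -
    have "v' \<in> lists A" by (rule relpow_rel_step_lists[OF rels_lists that(2) assms(2)])
    from walk_inject[OF assms(1,3) this, of x] show ?thesis using that(1) by blast
  qed
  then show ?thesis unfolding two_path_iff_relpow[OF assms(1,2)] by blast
qed

section \<open>Simple connectivity and the Dehn function of the complex in terms of the
  relations\<close>

lemma path_area_walk:
  "x \<in> carrier G \<Longrightarrow> u \<in> lists A \<Longrightarrow> v \<in> lists A \<Longrightarrow>
    path_area (K n cgraph) (path x u) (path x v) = word_area A (rels n) u v"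
  unfolding path_area_def word_area_def by (simp only: two_path_walk_iff)

text \<open>Surjectivity holds because \<open>A\<close> generates, and soundness because
  \<open>rels n\<close> contains only true relations; what remains is that every equality of values
  is derivable.\<close>

lemma presents_rels_iff:
  "presents G A (rels n) (\<lambda>a. a) \<longleftrightarrow>
    (\<forall>u\<in>lists A. \<forall>v\<in>lists A. val u = val v \<longrightarrow> (u, v) \<in> (rel_step A (rels n))\<^sup>*)"
proof -
  have "val u = val v" if "(u, v) \<in> (rel_step A (rels n))\<^sup>*" for u v
    by (rule word_value_rtrancl[OF A_Pi rels_lists rels_sound that])
  then have "(val u = val v \<longleftrightarrow> (u, v) \<in> (rel_step A (rels n))\<^sup>*) \<longleftrightarrow>
      (val u = val v \<longrightarrow> (u, v) \<in> (rel_step A (rels n))\<^sup>*)" for u v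
    by blast
  then show ?thesis
    unfolding presents_def using A_Pi generated_by_word_value[OF monoid_axioms gen] by simp
qed

lemma n_quasi_simply_connected_iff:
  "n_quasi_simply_connected n cgraph \<longleftrightarrow> presents G A (rels n) (\<lambda>a. a)"
proof -
  have two_path: "(\<exists>ds. two_path (K n cgraph) (path x u) ds (path x v)) \<longleftrightarrow>
      (u, v) \<in> (rel_step A (rels n))\<^sup>*"
    if "x \<in> carrier G" "u \<in> lists A" "v \<in> lists A" for x u v
    using two_path_walk_iff[OF that, of _ n] unfolding rtrancl_is_UN_relpow by blast
  show ?thesis
    unfolding n_quasi_simply_connected_def directed_simply_connected_def presents_rels_iff
  proof (intro iffI ballI allI impI)
    fix u v
    assume "\<forall>p q. parallel (skeleton (K n cgraph)) p q \<longrightarrow> (\<exists>ds. two_path (K n cgraph) p ds q)"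
      and uv: "u \<in> lists A" "v \<in> lists A" "val u = val v"
    \<comment> \<open>Derivability does not mention a base vertex, so it can be read off from the
      paths that start at the identity.\<close>
    moreover have "parallel (skeleton (K n cgraph)) (path \<one> u) (path \<one> v)"
      using parallel_walk_iff[OF one_closed one_closed uv(1,2)] uv(3) by (simp add: K_def)
    ultimately show "(u, v) \<in> (rel_step A (rels n))\<^sup>*"
      using two_path[OF one_closed uv(1,2)] by blast
  next
    fix p q
    assume *: "\<forall>u\<in>lists A. \<forall>v\<in>lists A.
        val u = val v \<longrightarrow> (u, v) \<in> (rel_step A (rels n))\<^sup>*"
      and "parallel (skeleton (K n cgraph)) p q"
    then have "parallel cgraph p q" by (simp add: K_def)
    then obtain x u v where "x \<in> carrier G" "u \<in> lists A" "v \<in> lists A" "val u = val v"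
      "p = path x u" "q = path x v"
      by (rule parallelE)
    then show "\<exists>ds. two_path (K n cgraph) p ds q" using * two_path by blast
  qed
qed

text \<open>A parallel pair has the same total length and area as its pair of labels, and every
  congruent pair of words labels a parallel pair at the identity. Both functions are therefore
  suprema of the same set of areas, and they agree exactly rather than only up to type.\<close>

lemma complex_dehn_eq_pres_dehn:
  assumes "presents G A (rels n) (\<lambda>a. a)"
  shows "complex_dehn (K n cgraph) i = enat (pres_dehn A (rels n) i)"
proof -
  let ?X = "{word_area A (rels n) u v | u v.
    (u, v) \<in> pres_cong A (rels n) \<and> length u + length v \<le> i}"
  have cong: "(u, v) \<in> pres_cong A (rels n) \<longleftrightarrow> u \<in> lists A \<and> v \<in> lists A \<and> val u = val v" for u v
    by (rule presents_pres_cong_iff[OF assms])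
  have "{enat (path_area (K n cgraph) p q) | p q.
      parallel (skeleton (K n cgraph)) p q \<and> vwalk_length p + vwalk_length q \<le> i} = enat ` ?X"
    (is "?Y = _")
  proof
    show "?Y \<subseteq> enat ` ?X"
    proof clarify
      fix p q assume *: "parallel (skeleton (K n cgraph)) p q" "vwalk_length p + vwalk_length q \<le> i"
      then have "parallel cgraph p q" by (simp add: K_def)
      then obtain x u v where "x \<in> carrier G" "u \<in> lists A" "v \<in> lists A" "val u = val v"
        "p = path x u" "q = path x v"
        by (rule parallelE)
      then show "enat (path_area (K n cgraph) p q) \<in> enat ` ?X"
        using *(2) by (auto simp: path_area_walk cong)
    qed
    show "enat ` ?X \<subseteq> ?Y"
    proof clarify
      fix u v assume *: "(u, v) \<in> pres_cong A (rels n)" "length u + length v \<le> i"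
      then have "parallel cgraph (path \<one> u) (path \<one> v)"
        "path_area (K n cgraph) (path \<one> u) (path \<one> v) = word_area A (rels n) u v"
        using cong parallel_walk_iff path_area_walk by auto
      then show "\<exists>p q. enat (word_area A (rels n) u v) = enat (path_area (K n cgraph) p q) \<and>
          parallel (skeleton (K n cgraph)) p q \<and> vwalk_length p + vwalk_length q \<le> i"
        using *(2) by (intro exI[of _ "path \<one> u"] exI[of _ "path \<one> v"]) (simp add: K_def)
    qed
  qed
  \<comment> \<open>On a finite nonempty set of \<open>enat\<close> values the supremum is the
    maximum, and the monotone embedding \<open>enat\<close> commutes with
    \<open>Max\<close>.\<close>
  moreover have "Sup (enat ` ?X) = enat (Max ?X)"
  proof -
    have X: "finite ?X" "?X \<noteq> {}"
      by (rule finite_areas[OF finite_A], rule areas_nonempty)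
    have "enat (Max ?X) = Max (enat ` ?X)"
      by (rule mono_Max_commute[OF _ X]) (simp add: mono_def)
    then show ?thesis using X by (simp only: Sup_enat_def finite_imageI image_is_empty if_True if_False)
  qed
  ultimately show ?thesis by (simp add: complex_dehn_def pres_dehn_def)
qed

text \<open>For large \<open>n\<close>, \<open>rels n\<close> contains the translations of all
  relations in \<open>R\<close> and all pairs of a generator with its round trip through
  \<open>B\<close>. An equality over \<open>A\<close> is then derived by passing to round trips,
  translating a derivation over \<open>R\<close>, and returning.\<close>

lemma finite_presentation_imp_presents_rels:
  fixes B :: "'b set"
  assumes "finite_presentation B R" "presents G B R e"
  shows "\<exists>n. presents G A (rels n) (\<lambda>a. a)"
proof -
  have fin: "finite B" "finite R" "R \<subseteq> lists B \<times> lists B"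
    using assms(1) by (auto simp: finite_presentation_def)
  have eB: "e \<in> B \<rightarrow> carrier G" using assms(2) by (simp add: presents_def)
  have "\<forall>b\<in>B. \<exists>w. w \<in> lists A \<and> val w = e b"
    using eB generated_by_word_value[OF monoid_axioms gen] by (fastforce simp: Pi_iff)
  then obtain f where "\<forall>b\<in>B. f b \<in> lists A \<and> val (f b) = e b" by metis
  then have f: "f \<in> B \<rightarrow> lists A" "\<forall>b\<in>B. val (f b) = e b" by auto
  obtain g where g: "g \<in> A \<rightarrow> lists B" "\<forall>a\<in>A. word_value G e (g a) = a"
    using presents_translation[OF assms(2) A_Pi] .
  obtain N1 where N1: "\<forall>p\<in>R. length (subst f (fst p)) + length (subst f (snd p)) \<le> N1"
    by (rule finite_uniform_bound[of R
          "\<lambda>p k. length (subst f (fst p)) + length (subst f (snd p)) \<le> k"])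
      (use fin(2) in auto)
  \<comment> \<open>The \<open>Suc\<close> accounts for the one-letter side \<open>[a]\<close> of
    the relation between \<open>a\<close> and its round trip.\<close>
  obtain N2 where N2: "\<forall>a\<in>A. Suc (length (subst f (g a))) \<le> N2"
    by (rule finite_uniform_bound[of A "\<lambda>a k. Suc (length (subst f (g a))) \<le> k"])
      (use finite_A in auto)
  define n where "n = N1 + N2"
  have rel1: "steps_le A (rels n) 1 l r" if "(l, r) \<in> rels n" for l r
    using rel_stepI[of "[]" A "[]" l r "rels n"] that by (intro steps_leI) simp
  have vf: "val (subst f w) = word_value G e w" if "w \<in> lists B" for w
    using word_value_subst[OF A_Pi f(1) that f(2)] .
  have "\<forall>(l, r)\<in>R. steps_le A (rels n) 1 (subst f l) (subst f r)"
  proof clarify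
    fix l r assume lr: "(l, r) \<in> R"
    then have *: "l \<in> lists B" "r \<in> lists B" using fin(3) by auto
    have "length (subst f l) + length (subst f r) \<le> n" using N1 lr by (force simp: n_def)
    moreover have "val (subst f l) = val (subst f r)"
      using presents_imp_relations_hold[OF assms(2) fin(3)] lr vf * by auto
    ultimately have "(subst f l, subst f r) \<in> rels n"
      using subst_lists[OF f(1) *(1)] subst_lists[OF f(1) *(2)]
      unfolding cell_relations_def by blast
    then show "steps_le A (rels n) 1 (subst f l) (subst f r)" by (rule rel1)
  qed
  note rel_f = steps_le_subst[OF _ this f(1)]
  have fg: "subst f (g a) \<in> lists A" if "a \<in> A" for a
    using subst_lists[OF f(1)] g(1) that by blast
  have "\<forall>a\<in>A. steps_le A (rels n) 1 [a] (subst f (g a))"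
  proof
    fix a assume a: "a \<in> A"
    then have "g a \<in> lists B" using g(1) by blast
    then have "val (subst f (g a)) = a" using vf g(2) a by simp
    then have "([a], subst f (g a)) \<in> rels n"
      using a fg[OF a] N2 A_closed by (auto simp: cell_relations_def n_def le_diff_conv)
    then show "steps_le A (rels n) 1 [a] (subst f (g a))" by (rule rel1)
  qed
  note expand = steps_le_subst_letters[OF _ this, simplified subst_subst[symmetric]]
  have expand: "\<exists>k. steps_le A (rels n) k w (subst f (subst g w))" if "w \<in> lists A" for w
    using expand[OF that] fg by (auto simp: Pi_iff)
  have "presents G A (rels n) (\<lambda>a. a)"
    unfolding presents_rels_iff
  proof (intro ballI impI)
    fix u v assume u: "u \<in> lists A" and v: "v \<in> lists A" and eq: "val u = val v"
    have "word_value G e (subst g u) = word_value G e (subst g v)"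
      using word_value_subst[OF eB g(1) u g(2)] word_value_subst[OF eB g(1) v g(2)] eq by simp
    then have "(subst g u, subst g v) \<in> (rel_step B R)\<^sup>*"
      using assms(2) subst_lists[OF g(1) u] subst_lists[OF g(1) v] unfolding presents_def by blast
    then obtain i where "(subst g u, subst g v) \<in> rel_step B R ^^ i"
      using rtrancl_imp_relpow by blast
    then have "steps_le A (rels n) (1 * i) (subst f (subst g u)) (subst f (subst g v))"
      by (rule rel_f)
    then show "(u, v) \<in> (rel_step A (rels n))\<^sup>*"
      using expand[OF u] expand[OF v]
      unfolding rtrancl_iff_steps_le by (meson steps_le_trans steps_le_sym)
  qed
  then show ?thesis ..
qed

end

section \<open>Renaming the letters of a presentation\<close>

lemma (in monoid) presents_rename:
  assumes "presents G B R e" "R \<subseteq> lists B \<times> lists B" "inj_on g B"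
  shows "presents G (g ` B) (map_prod (map g) (map g) ` R) (e \<circ> inv_into B g)"
proof -
  let ?h = "inv_into B g" and ?B = "g ` B" and ?R = "map_prod (map g) (map g) ` R"
  let ?e = "e \<circ> ?h"
  have eB: "e \<in> B \<rightarrow> carrier G" using assms(1) by (simp add: presents_def)
  have h: "?h \<in> ?B \<rightarrow> B" using inv_into_into[of _ g B] by auto
  have eB': "?e \<in> ?B \<rightarrow> carrier G" using eB h by (auto simp: Pi_iff)
  have gh: "map g (map ?h w) = w" if "w \<in> lists ?B" for w
    using that by (induction w) (auto simp: f_inv_into_f)
  have hl: "map ?h w \<in> lists B" if "w \<in> lists ?B" for w
    using that h by (induction w) auto
  have gl: "map g w \<in> lists ?B" if "w \<in> lists B" for w
    using that by auto
  have word_val: "word_value G ?e w = word_value G e (map ?h w)" for w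
    by (induction w) auto
  have word_val_g: "word_value G ?e (map g w) = word_value G e w" if "w \<in> lists B" for w
    using that assms(3) by (induction w) auto
  have R': "?R \<subseteq> lists ?B \<times> lists ?B" using assms(2) gl by fastforce
  have sound: "\<forall>(l, r)\<in>?R. word_value G ?e l = word_value G ?e r"
  proof clarify
    fix l r assume "(l, r) \<in> R"
    moreover from this have "l \<in> lists B" "r \<in> lists B" using assms(2) by auto
    ultimately show "word_value G ?e (map g l) = word_value G ?e (map g r)"
      using presents_imp_relations_hold[OF assms(1,2)] word_val_g by auto
  qed
  \<comment> \<open>Renaming is a substitution by one-letter words, so the general translation of
    derivations applies, with a single step for each relation.\<close>
  have subst_g: "subst (\<lambda>b. [g b]) w = map g w" for w by (induction w) auto
  have "\<forall>(l, r)\<in>R. steps_le ?B ?R 1 (subst (\<lambda>b. [g b]) l) (subst (\<lambda>b. [g b]) r)"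
  proof clarify
    fix l r assume "(l, r) \<in> R"
    then have "([] @ map g l @ [], [] @ map g r @ []) \<in> rel_step ?B ?R"
      by (intro rel_stepI) force+
    then show "steps_le ?B ?R 1 (subst (\<lambda>b. [g b]) l) (subst (\<lambda>b. [g b]) r)"
      unfolding subst_g by (intro steps_leI) simp
  qed
  note steps = steps_le_subst[OF _ this, unfolded subst_g]
  show ?thesis
    unfolding presents_def
  proof (intro conjI ballI subsetI iffI)
    fix x assume "x \<in> carrier G"
    then obtain w where "w \<in> lists B" "x = word_value G e w"
      using assms(1) unfolding presents_def by blast
    then show "x \<in> word_value G ?e ` lists ?B"
      using word_val_g gl by (metis image_eqI)
  next
    fix u v assume uv: "u \<in> lists ?B" "v \<in> lists ?B" "word_value G ?e u = word_value G ?e v"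
    \<comment> \<open>The equality is pulled back along the inverse renaming and derived over
      \<open>B\<close>; the derivation is then pushed forward along \<open>g\<close>, where
      \<open>map g\<close> undoes \<open>map ?h\<close>.\<close>
    then have "(map ?h u, map ?h v) \<in> (rel_step B R)\<^sup>*"
      using assms(1) hl word_val unfolding presents_def by metis
    then obtain i where "(map ?h u, map ?h v) \<in> rel_step B R ^^ i"
      using rtrancl_imp_relpow by blast
    from steps[OF this] show "(u, v) \<in> (rel_step ?B ?R)\<^sup>*"
      using gh uv(1,2) unfolding rtrancl_iff_steps_le by auto
  next
    fix u v assume "(u, v) \<in> (rel_step ?B ?R)\<^sup>*"
    then show "word_value G ?e u = word_value G ?e v"
      by (rule word_value_rtrancl[OF eB' R' sound])
  qed (use eB' in auto)
qed

text \<open>\<open>finitely_presented\<close> quantifies over alphabets of natural numbers only, so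
  a finite alphabet of any type is first embedded into \<open>nat\<close>.\<close>

lemma (in monoid) finitely_presentedI:
  assumes "finite_presentation B R" "presents G B R e"
  shows "finitely_presented G"
proof -
  have fin: "finite B" "finite R" "R \<subseteq> lists B \<times> lists B"
    using assms(1) by (auto simp: finite_presentation_def)
  obtain g :: "_ \<Rightarrow> nat" where g: "inj_on g B"
    using finite_imp_inj_to_nat_seg[OF fin(1)] by auto
  have "finite_presentation (g ` B) (map_prod (map g) (map g) ` R)"
    using fin by (fastforce simp: finite_presentation_def)
  then show ?thesis
    using presents_rename[OF assms(2) fin(3) g] defined_by_iff_presents
    unfolding finitely_presented_def by blast
qed

theorem theorem3p1:
  fixes S :: "('a, 'm) monoid_scheme" and A :: "'a set"
  assumes "monoid S"
    and "left_cancellative S"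
    and "finite A"
    and "generated_by S A"
  shows "(finitely_presented S \<longleftrightarrow> quasi_simply_connected (cayley_graph S A)) \<and>
    (\<forall>n. n_quasi_simply_connected n (cayley_graph S A) \<longrightarrow>
       (\<forall>(B :: 'b set) (R :: ('b list \<times> 'b list) set).
          finite_presentation B R \<and> defined_by S B R \<longrightarrow>
          same_type (complex_dehn (K n (cayley_graph S A))) (\<lambda>i. enat (pres_dehn B R i))))"
proof -
  interpret left_cancellative_generated S A
    using assms by (simp add: left_cancellative_generated_def left_cancellative_generated_axioms_def)
  \<comment> \<open>A finite presentation supplies a suitable \<open>n\<close>; conversely,
    \<open>rels n\<close> over the finite set \<open>A\<close> is itself a finite
    presentation.\<close>
  have "finitely_presented S \<longleftrightarrow> quasi_simply_connected cgraph"
    using finite_presentation_imp_presents_rels finitely_presentedI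
      finite_presentation_cell_relations[OF finite_A]
    unfolding quasi_simply_connected_def n_quasi_simply_connected_iff
      finitely_presented_def defined_by_iff_presents
    by blast
  moreover have "same_type (complex_dehn (K n cgraph)) (\<lambda>i. enat (pres_dehn B R i))"
    if "n_quasi_simply_connected n cgraph" and B: "finite_presentation B R"
      and def: "defined_by S B R"
    for n and B :: "'b set" and R
  proof -
    note fp = finite_presentation_cell_relations[OF finite_A, of S n]
    have n: "presents S A (rels n) (\<lambda>a. a)" using that(1) n_quasi_simply_connected_iff by simp
    obtain e where e: "presents S B R e" using def defined_by_iff_presents by auto
    \<comment> \<open>This replaces the complex by the finite presentation \<open>rels n\<close>
      over \<open>A\<close>; domination between it and \<open>R\<close> over \<open>B\<close> then
      holds in both directions.\<close>
    have "complex_dehn (K n cgraph) = (\<lambda>i. enat (pres_dehn A (rels n) i))"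
      using complex_dehn_eq_pres_dehn[OF n] by blast
    then show ?thesis
      using pres_dehn_dominated[OF fp n B e] pres_dehn_dominated[OF B e fp n]
      by (simp add: same_type_def)
  qed
  ultimately show ?thesis by blast
qed

end
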